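(* For all real $a,b$, $$\frac{2}{\pi}\int_0^\infty \int_0^\infty\frac{\sin xy}{\sinh\sqrt{\pi} x\,\sinh\sqrt{\pi}y}\cos ax\,\cos by\,dx\,dy=\frac{\sin ab}{\sinh\sqrt{\pi} a\, \sinh\sqrt{\pi}b},$$ where for $a=0$ or $b=0$ the right-hand side is understood as its limiting value.
   Context: Here $\sinh\sqrt{\pi}x$ means $\sinh(\sqrt{\pi}\,x)$, and similarly for the other terms. *)

theory Defs
  imports "HOL-Analysis.Analysis"
begin

definition hyp_kernel :: "real \<Rightarrow> real \<Rightarrow> real" where
  "hyp_kernel x y = sin (x * y) / (sinh (sqrt pi * x) * sinh (sqrt pi * y))"

definition cos_transform2 :: "(real \<Rightarrow> real \<Rightarrow> real) \<Rightarrow> real \<Rightarrow> real \<Rightarrow> real" where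
  "cos_transform2 f a b =
     2 / pi * (LBINT y=0..\<infinity>. (LBINT x=0..\<infinity>. f x y * cos (a * x) * cos (b * y)))"

end

theory Submission
  imports
    Defs
    "HOL-Complex_Analysis.Complex_Analysis"
    "HOL-Probability.Sinc_Integral"
    "HOL-Real_Asymp.Real_Asymp"
begin

text \<open>
  Writing \<open>c = sqrt pi\<close>, the inner integral of \<open>sin (x y) cos (a x) / sinh (c x)\<close> over \<open>x\<close> is
  \<open>c / 2 * sinh (c y) / (cosh (c y) + cosh (c a))\<close>: its factor \<open>sinh (c y)\<close> cancels the one in the kernel.
  What remains is the Fourier integral of \<open>1 / (cosh (c y) + cosh (c a))\<close>, which the residue theorem
  evaluates on a rectangle of height \<open>2 pi\<close> (after scaling), because the integrand is quasi-periodic with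
  respect to \<open>2 pi i\<close>. The reduced single integral is also continuous in \<open>(a, b)\<close> by dominated
  convergence, which settles the limiting values on the axes.
\<close>

section \<open>Comparing integrals along two horizontal lines\<close>

text \<open>Far out, the decay hypothesis dominates \<open>f\<close> by a multiple of
  \<open>1 / (1 + x^2)\<close>. On the remaining compact interval continuity bounds
  \<open>norm (f x) * (1 + x^2)\<close>. The larger of the two constants serves on the whole
  line.\<close>

lemma integrable_of_inverse_square_decay:
  fixes f :: "real \<Rightarrow> 'a::euclidean_space"
  assumes cont: "continuous_on UNIV f"
    and bound: "\<And>x. r \<le> \<bar>x\<bar> \<Longrightarrow> norm (f x) \<le> B \<bar>x\<bar>"
    and B: "B \<in> O(\<lambda>x. 1 / x\<^sup>2)"
  shows "integrable lborel f"
proof -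
  \<comment> \<open>The majorant is exchanged for one that is finite at 0 and integrable over the
    whole line.\<close>
  have "(\<lambda>x::real. 1 / x\<^sup>2) \<in> O(\<lambda>x. 1 / (1 + x\<^sup>2))"
    by real_asymp
  then have "B \<in> O(\<lambda>x. 1 / (1 + x\<^sup>2))"
    by (rule landau_o.big_trans[OF B])
  then obtain c where c: "c > 0" and "\<forall>\<^sub>F x in at_top. norm (B x) \<le> c * norm (1 / (1 + x\<^sup>2))"
    by (rule landau_o.bigE)
  then obtain N where N: "\<And>x. x \<ge> N \<Longrightarrow> norm (B x) \<le> c * norm (1 / (1 + x\<^sup>2))"
    by (auto simp: eventually_at_top_linorder)
  define s where "s = max r N"
  have "compact ((\<lambda>x. norm (f x) * (1 + x\<^sup>2)) ` {-s..s})"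
    by (intro compact_continuous_image continuous_intros continuous_on_subset[OF cont]) auto
  then have "bdd_above ((\<lambda>x. norm (f x) * (1 + x\<^sup>2)) ` {-s..s})"
    by (intro bounded_imp_bdd_above compact_imp_bounded)
  then obtain M where M: "\<forall>x\<in>{-s..s}. norm (f x) * (1 + x\<^sup>2) \<le> M"
    by (auto simp: bdd_above_def)
  have bd: "norm (f x) \<le> max c M * inverse (1 + x\<^sup>2)" for x
  proof -
    have pos: "1 + x\<^sup>2 > 0"
      by (simp add: add_pos_nonneg)
    have "norm (f x) * (1 + x\<^sup>2) \<le> max c M"
    proof (cases "\<bar>x\<bar> \<le> s")
      case True
      then have "norm (f x) * (1 + x\<^sup>2) \<le> M"
        using M by (simp add: abs_le_iff)
      then show ?thesis
        by (rule max.coboundedI2)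
    next
      case False
      then have "r \<le> \<bar>x\<bar>" "N \<le> \<bar>x\<bar>"
        by (auto simp: s_def)
      then have "norm (f x) \<le> c * (1 / (1 + x\<^sup>2))"
        using bound[of x] N[of "\<bar>x\<bar>"] by simp
      then have "norm (f x) * (1 + x\<^sup>2) \<le> c"
        using pos by (simp add: pos_le_divide_eq)
      then show ?thesis
        by simp
    qed
    then show ?thesis
      using pos by (simp add: pos_le_divide_eq flip: divide_inverse)
  qed
  have "integrable lborel (\<lambda>x::real. inverse (1 + x\<^sup>2))"
    using integrable_inverse_1_plus_square by (simp add: set_integrable_def)
  then have "integrable lborel (\<lambda>x::real. max c M * inverse (1 + x\<^sup>2))"
    by simp
  then show ?thesis
  proof (rule Bochner_Integration.integrable_bound)
    show "f \<in> borel_measurable lborel"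
      using cont by (simp add: borel_measurable_continuous_onI)
    show "AE x in lborel. norm (f x) \<le> norm (max c M * inverse (1 + x\<^sup>2))"
      using bd by (intro AE_I2) (auto intro: order_trans[OF _ abs_ge_self])
  qed
qed

text \<open>Dominated convergence with majorant \<open>norm (f x)\<close>. The truncated integrals
  take the form in which contour integrals along real segments appear.\<close>

lemma tendsto_integral_symmetric_interval:
  fixes f :: "real \<Rightarrow> 'a::euclidean_space"
  assumes f: "integrable lborel f"
  shows "((\<lambda>R. integral {-R..R} f) \<longlongrightarrow> integral\<^sup>L lborel f) at_top"
proof -
  have "((\<lambda>R. LINT x|lborel. indicator {-R..R} x *\<^sub>R f x) \<longlongrightarrow> integral\<^sup>L lborel f) at_top"
  proof (rule integral_dominated_convergence_at_top)
    show "integrable lborel (\<lambda>x. norm (f x))"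
      using f by simp
    show "AE x in lborel. ((\<lambda>R. indicator {-R..R} x *\<^sub>R f x) \<longlongrightarrow> f x) at_top"
    proof
      fix x
      have "\<forall>\<^sub>F R in at_top. indicator {-R..R} x *\<^sub>R f x = f x"
        using eventually_ge_at_top[of "\<bar>x\<bar>"] by eventually_elim (auto simp: indicator_def)
      then show "((\<lambda>R. indicator {-R..R} x *\<^sub>R f x) \<longlongrightarrow> f x) at_top"
        by (rule tendsto_eventually)
    qed
    show "\<forall>\<^sub>F R in at_top. AE x in lborel. norm (indicator {-R..R} x *\<^sub>R f x) \<le> norm (f x)"
      by (intro always_eventually allI) (auto simp: indicator_def)
  qed (use f in auto)
  moreover have "(LINT x|lborel. indicator {-R..R} x *\<^sub>R f x) = integral {-R..R} f" for R
  proof -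
    have "set_integrable lborel {-R..R} f"
      using f unfolding set_integrable_def by (intro integrable_mult_indicator) auto
    from set_borel_integral_eq_integral(2)[OF this] show ?thesis
      by (simp add: set_lebesgue_integral_def)
  qed
  ultimately show ?thesis by simp
qed

section \<open>Integration along the sides of a rectangle\<close>

lemma contour_integral_linepath_translate:
  "contour_integral (linepath (a + w) (b + w)) f = contour_integral (linepath a b) (\<lambda>z. f (z + w))"
proof -
  have "linepath (a + w) (b + w) x = linepath a b x + w" for x
    by (simp add: linepath_def algebra_simps)
  then show ?thesis
    by (simp add: contour_integral_integral)
qed

text \<open>The horizontal sides of the rectangle contribute the difference of the truncated
  integrals, the top side being traversed backwards; the vertical sides contribute at most
  \<open>2 * \<bar>B R\<bar> * h\<close>, which tends to 0. Keeping \<open>C\<close> abstract covers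
  both an enclosed sum of residues and the pole-free case \<open>C = 0\<close>.\<close>

lemma integral_horizontal_lines_diff:
  fixes f :: "complex \<Rightarrow> complex"
  assumes h: "0 < h"
    and contour: "\<And>R. r \<le> R \<Longrightarrow> (f has_contour_integral C) (rectpath (Complex (-R) 0) (Complex R h))"
    and bound: "\<And>z. 0 \<le> Im z \<Longrightarrow> Im z \<le> h \<Longrightarrow> r \<le> \<bar>Re z\<bar> \<Longrightarrow> norm (f z) \<le> B \<bar>Re z\<bar>"
    and B: "B \<in> O(\<lambda>x. 1 / x\<^sup>2)"
    and cont0: "continuous_on UNIV (\<lambda>x::real. f x)"
    and cont1: "continuous_on UNIV (\<lambda>x::real. f (x + \<i> * h))"
  shows "integrable lborel (\<lambda>x::real. f x)"
    and "integrable lborel (\<lambda>x::real. f (x + \<i> * h))"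
    and "(LINT x|lborel. f (complex_of_real x)) - (LINT x|lborel. f (complex_of_real x + \<i> * h)) = C"
proof -
  show int0: "integrable lborel (\<lambda>x::real. f x)"
    by (rule integrable_of_inverse_square_decay[OF cont0 _ B, of r]) (use h bound[of "complex_of_real _"] in auto)
  show int1: "integrable lborel (\<lambda>x::real. f (x + \<i> * h))"
    by (rule integrable_of_inverse_square_decay[OF cont1 _ B, of r]) (use h bound[of "complex_of_real _ + \<i> * h"] in auto)
  define I where "I R = integral {-R..R} (\<lambda>x. f (complex_of_real x)) -
    integral {-R..R} (\<lambda>x. f (complex_of_real x + \<i> * h))" for R
  have lim: "(I \<longlongrightarrow> (LINT x|lborel. f (complex_of_real x)) - (LINT x|lborel. f (complex_of_real x + \<i> * h))) at_top"
    unfolding I_def by (intro tendsto_diff tendsto_integral_symmetric_interval int0 int1)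
  \<comment> \<open>Since \<open>r\<close> is arbitrary, the 1 in the maximum ensures that
    \<open>R\<close> is positive, hence \<open>\<bar>R\<bar> = R\<close>.\<close>
  have "norm (I R - C) \<le> 2 * (\<bar>B R\<bar> * h)" if R: "R \<ge> max r 1" for R
  proof -
    define p1 where "p1 = linepath (Complex (-R) 0) (Complex R 0)"
    define p2 where "p2 = linepath (Complex R 0) (Complex R h)"
    define p3 where "p3 = linepath (Complex R h) (Complex (-R) h)"
    define p4 where "p4 = linepath (Complex (-R) h) (Complex (-R) 0)"
    have path: "rectpath (Complex (-R) 0) (Complex R h) = p1 +++ p2 +++ p3 +++ p4"
      by (simp add: rectpath_def Let_def p1_def p2_def p3_def p4_def)
    have [simp]: "valid_path p1" "valid_path p2" "valid_path p3" "valid_path p4"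
      "pathfinish p1 = pathstart p2" "pathfinish p2 = pathstart p3" "pathfinish p3 = pathstart p4"
      by (simp_all add: p1_def p2_def p3_def p4_def)
    have C: "(f has_contour_integral C) (p1 +++ p2 +++ p3 +++ p4)"
      using contour[of R] R by (simp add: path)
    then have ci: "f contour_integrable_on p1" "f contour_integrable_on p2"
        "f contour_integrable_on p3" "f contour_integrable_on p4"
      using has_contour_integral_integrable[OF C] by (simp_all add: valid_path_join)
    have sum: "C = contour_integral p1 f + contour_integral p2 f + contour_integral p3 f + contour_integral p4 f"
      using contour_integral_unique[OF C] ci by (simp add: valid_path_join add.assoc)
    have "contour_integral p1 f = integral {-R..R} (\<lambda>x. f (complex_of_real x))"
      unfolding p1_def using R by (subst contour_integral_linepath_Reals_eq) (auto simp: complex_is_Real_iff)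
    moreover have "contour_integral p3 f = - integral {-R..R} (\<lambda>x. f (complex_of_real x + \<i> * h))"
    proof -
      have "contour_integral p3 f = - contour_integral (linepath (Complex (-R) h) (Complex R h)) f"
        using contour_integral_reversepath[of "linepath (Complex (-R) h) (Complex R h)" f]
        by (simp add: p3_def)
      \<comment> \<open>The top side is a translate of a real segment, to which the formula for
        contour integrals along the real axis applies.\<close>
      also have "linepath (Complex (-R) h) (Complex R h) = linepath (Complex (-R) 0 + \<i> * h) (Complex R 0 + \<i> * h)"
        by (rule arg_cong2[of _ _ _ _ linepath]) (simp_all add: complex_eq_iff)
      also have "contour_integral \<dots> f = integral {-R..R} (\<lambda>x. f (complex_of_real x + \<i> * h))"
        using R unfolding contour_integral_linepath_translate
        by (subst contour_integral_linepath_Reals_eq) (auto simp: complex_is_Real_iff)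
      finally show ?thesis .
    qed
    moreover have "norm (contour_integral p2 f) \<le> \<bar>B R\<bar> * norm (Complex R h - Complex R 0)"
      unfolding p2_def
    proof (rule contour_integral_bound_linepath)
      fix z assume "z \<in> closed_segment (Complex R 0) (Complex R h)"
      then have "Re z = R" "0 \<le> Im z" "Im z \<le> h"
        using h by (auto simp: closed_segment_same_Re closed_segment_eq_real_ivl)
      then show "norm (f z) \<le> \<bar>B R\<bar>"
        using bound[of z] R by auto
    qed (use ci in \<open>auto simp: p2_def\<close>)
    moreover have "norm (contour_integral p4 f) \<le> \<bar>B R\<bar> * norm (Complex (-R) 0 - Complex (-R) h)"
      unfolding p4_def
    proof (rule contour_integral_bound_linepath)
      fix z assume "z \<in> closed_segment (Complex (-R) h) (Complex (-R) 0)"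
      then have "Re z = -R" "0 \<le> Im z" "Im z \<le> h"
        using h by (auto simp: closed_segment_same_Re closed_segment_eq_real_ivl)
      then show "norm (f z) \<le> \<bar>B R\<bar>"
        using bound[of z] R by auto
    qed (use ci in \<open>auto simp: p4_def\<close>)
    moreover have "norm (Complex R h - Complex R 0) = h" "norm (Complex (-R) 0 - Complex (-R) h) = h"
      using h by (simp_all add: cmod_def)
    ultimately show ?thesis
      using norm_triangle_ineq[of "contour_integral p2 f" "contour_integral p4 f"]
      by (simp add: sum I_def norm_minus_commute algebra_simps)
  qed
  then have "\<forall>\<^sub>F R in at_top. norm (I R - C) \<le> 2 * (\<bar>B R\<bar> * h)"
    by (rule eventually_at_top_linorderI)
  moreover have "((\<lambda>R. 2 * (\<bar>B R\<bar> * h)) \<longlongrightarrow> 0) at_top"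
  proof -
    have "(\<lambda>x::real. 1 / x\<^sup>2) \<in> o(\<lambda>x. 1)"
      by real_asymp
    then have "B \<in> o(\<lambda>x. 1)"
      by (rule landau_o.big_small_trans[OF B])
    then have "(B \<longlongrightarrow> 0) at_top"
      using smalloD_tendsto by fastforce
    then show ?thesis
      by (auto intro!: tendsto_eq_intros)
  qed
  ultimately have "((\<lambda>R. I R - C) \<longlongrightarrow> 0) at_top"
    by (rule Lim_null_comparison)
  then have "(I \<longlongrightarrow> C) at_top"
    by (rule LIM_zero_cancel)
  then show "(LINT x|lborel. f (complex_of_real x)) - (LINT x|lborel. f (complex_of_real x + \<i> * h)) = C"
    by (rule tendsto_unique[OF trivial_limit_at_top_linorder lim])
qed

section \<open>The Fourier integrals\<close>

text \<open>The reverse triangle inequality, applied to \<open>exp z\<close> and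
  \<open>exp (-z)\<close>, whose norms depend on \<open>Re z\<close> only. These lower bounds make
  the integrands decay on the vertical sides, uniformly in \<open>Im z\<close>.\<close>

lemma sinh_le_norm_sinh: "sinh \<bar>Re z\<bar> \<le> norm (sinh z :: complex)"
  and sinh_le_norm_cosh: "sinh \<bar>Re z\<bar> \<le> norm (cosh z :: complex)"
proof -
  have eq: "sinh \<bar>Re z\<bar> = \<bar>norm (exp z) - norm (exp (-z))\<bar> / 2"
    by (simp only: sinh_real_abs) (simp add: sinh_field_def abs_divide norm_exp_eq_Re)
  show "sinh \<bar>Re z\<bar> \<le> norm (sinh z)"
    using norm_triangle_ineq3[of "exp z" "exp (-z)"]
    unfolding eq by (simp add: sinh_field_def norm_divide)
  show "sinh \<bar>Re z\<bar> \<le> norm (cosh z)"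
    using norm_triangle_ineq3[of "exp z" "- exp (-z)"]
    unfolding eq by (simp add: cosh_field_def norm_divide)
qed

lemma sinh_eq_0_imp:
  fixes z :: complex
  assumes "sinh z = 0"
  obtains n :: int where "z = \<i> * (of_int n * pi)"
proof -
  obtain n :: int where "\<i> * z = complex_of_real (n * pi)"
    using assms by (auto simp: sinh_conv_sin sin_eq_0)
  then have "z = \<i> * (of_int (-n) * pi)"
    by (simp add: complex_eq_iff)
  then show thesis
    by (rule that)
qed

text \<open>The factorisation serves twice: over the complex numbers it locates the poles of
  \<open>1 / (cosh z + cosh A)\<close>, over the reals it combines two values of
  \<open>tanh\<close>.\<close>

lemma cosh_add_cosh: "cosh z + cosh w = 2 * cosh ((z + w) / 2) * cosh ((z - w) / 2)"
  for z w :: "'a :: {real_normed_field, banach}"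
proof -
  have "z = (z + w) / 2 + (z - w) / 2" "w = (z + w) / 2 - (z - w) / 2"
    by (simp_all add: field_simps)
  then have "cosh z = cosh ((z + w) / 2 + (z - w) / 2)" "cosh w = cosh ((z + w) / 2 - (z - w) / 2)"
    by presburger+
  then show ?thesis
    by (simp add: cosh_add cosh_diff)
qed

text \<open>The zeros are the odd multiples of \<open>i pi\<close>; the open strip ends exactly at
  the neighbours \<open>- i pi\<close> and \<open>3 i pi\<close> of the middle one.\<close>

lemma cosh_half_eq_0_imp:
  fixes u :: complex
  assumes "cosh (u / 2) = 0" "\<bar>Im u - pi\<bar> < 2 * pi"
  shows "u = \<i> * pi"
proof -
  obtain n :: int where n: "\<i> * (u / 2) = complex_of_real (n * pi) + of_real pi / 2"
    using assms(1) unfolding cosh_conv_cos cos_eq_0 by auto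
  then have u: "u = - \<i> * (2 * of_int n * pi + pi)"
    by (simp add: complex_eq_iff field_simps)
  then have "Im u = - (2 * n * pi + pi)"
    by simp
  then have "Im u - pi = - (real_of_int (n + 1) * (2 * pi))"
    by (simp add: algebra_simps)
  then have "\<bar>real_of_int (n + 1)\<bar> * (2 * pi) < 1 * (2 * pi)"
    using assms(2) by (simp add: abs_mult del: of_int_add)
  then have "\<bar>real_of_int (n + 1)\<bar> < 1"
    by (subst (asm) mult_less_cancel_right_pos) auto
  then have "n = -1"
    by linarith
  then show ?thesis
    by (simp add: u)
qed

text \<open>After factorisation, narrowing the strip by \<open>\<bar>Im A\<bar>\<close> leaves both
  \<open>z + A\<close> and \<open>z - A\<close> in the strip where \<open>cosh (u / 2)\<close> has a
  single zero.\<close>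

lemma cosh_add_cosh_eq_0_imp:
  fixes z A :: complex
  assumes "cosh z + cosh A = 0" "\<bar>Im z - pi\<bar> < 2 * pi - \<bar>Im A\<bar>"
  shows "z = \<i> * pi - A \<or> z = \<i> * pi + A"
proof -
  have "cosh ((z + A) / 2) = 0 \<or> cosh ((z - A) / 2) = 0"
    using assms(1) by (simp add: cosh_add_cosh)
  moreover have "\<bar>Im (z + A) - pi\<bar> < 2 * pi" "\<bar>Im (z - A) - pi\<bar> < 2 * pi"
    using assms(2) by auto
  ultimately have "z + A = \<i> * pi \<or> z - A = \<i> * pi"
    using cosh_half_eq_0_imp by blast
  then show ?thesis
    by (auto simp: algebra_simps)
qed

lemma cosh_i_times: "cosh (\<i> * of_real y) = of_real (cos y)"
  and sinh_i_times: "sinh (\<i> * of_real y) = \<i> * of_real (sin y)"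
  by (simp_all add: cosh_conv_cos sinh_conv_sin cos_of_real sin_of_real flip: mult.assoc)

lemma cosh_i_pi_add: "cosh (\<i> * pi + A) = - cosh A"
  and sinh_i_pi_add: "sinh (\<i> * pi + A) = - sinh A"
  for A :: complex
proof -
  have "cosh (\<i> * pi) = -1" "sinh (\<i> * pi) = 0"
    by (simp_all add: cosh_i_times sinh_i_times)
  then show "cosh (\<i> * pi + A) = - cosh A" "sinh (\<i> * pi + A) = - sinh A"
    by (simp_all add: cosh_add sinh_add)
qed

section \<open>The Fourier integral of \<open>1 / (cosh z + cosh A)\<close>\<close>

lemma fourier_integral_inverse_cosh_add_cosh:
  fixes A :: complex and b :: real
  assumes A: "A \<noteq> 0" "\<bar>Im A\<bar> < pi" and b: "b \<noteq> 0"
  defines "f \<equiv> \<lambda>z. exp (\<i> * b * z) / (cosh z + cosh A)"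
  shows "integrable lborel (\<lambda>x::real. f x)"
    and "(LINT x|lborel. f (complex_of_real x)) = 2 * pi * sin (b * A) / (sinh A * sinh (pi * b))"
proof -
  \<comment> \<open>An open neighbourhood of the closed strip
    \<open>0 \<le> Im z \<le> 2 pi\<close>, still so narrow that the denominator vanishes only on
    \<open>pts\<close>.\<close>
  define S where "S = {z. \<bar>Im z - pi\<bar> < 2 * pi - \<bar>Im A\<bar>}"
  define pts where "pts = {\<i> * pi - A, \<i> * pi + A}"
  \<comment> \<open>Beyond \<open>r\<close>, \<open>sinh \<bar>Re z\<bar>\<close> exceeds
    \<open>norm (cosh A)\<close>, so that \<open>B\<close> has a positive denominator, and the
    rectangle contains both poles.\<close>
  define r where "r = 1 + norm (cosh A) + \<bar>Re A\<bar>"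
  define B where "B t = exp (2 * pi * \<bar>b\<bar>) / (sinh t - norm (cosh A))" for t :: real
  \<comment> \<open>This is \<open>2 pi i\<close> times the sum of the two residues.\<close>
  define C where "C = 4 * pi * sin (b * A) * exp (- pi * b) / sinh A"
  have S: "S = {z. Im z < 3 * pi - \<bar>Im A\<bar>} \<inter> {z. Im z > - pi + \<bar>Im A\<bar>}"
    by (auto simp: S_def)
  have "open S" "convex S"
    unfolding S by (intro open_Int open_halfspace_Im_lt open_halfspace_Im_gt convex_Int
        convex_halfspace_Im_lt convex_halfspace_Im_gt)+
  have nz: "cosh z + cosh A \<noteq> 0" if "z \<in> S - pts" for z
    using cosh_add_cosh_eq_0_imp[of z A] that by (auto simp: S_def pts_def)
  have sinhA: "sinh A \<noteq> 0"
  proof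
    assume "sinh A = 0"
    then obtain n :: int where n: "A = \<i> * (of_int n * pi)"
      by (rule sinh_eq_0_imp)
    then have "\<bar>real_of_int n\<bar> * pi < 1 * pi"
      using A(2) by (simp add: abs_mult)
    then have "n = 0"
      by (subst (asm) mult_less_cancel_right_pos) auto
    with n A(1) show False by simp
  qed
  have holo_cosh: "cosh holomorphic_on T" for T :: "complex set"
    unfolding cosh_field_def by (intro holomorphic_intros) auto
  have holo: "f holomorphic_on S - pts"
    unfolding f_def using nz by (intro holomorphic_intros holo_cosh) auto
  have pts: "pts \<subseteq> S"
    using A(2) by (auto simp: pts_def S_def)
  have res: "residue f p = exp (\<i> * b * p) / sinh p" if p: "p \<in> pts" for p
    unfolding f_def
  proof (rule residue_simple_pole_deriv[of _ UNIV])
    show "((\<lambda>z. cosh z + cosh A) has_field_derivative sinh p) (at p)"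
      by (auto intro!: derivative_eq_intros)
    show "cosh p + cosh A = 0"
      using p cosh_i_pi_add[of A] cosh_i_pi_add[of "-A"] by (auto simp: pts_def)
    show "sinh p \<noteq> 0"
      using p sinhA sinh_i_pi_add[of A] sinh_i_pi_add[of "-A"] by (auto simp: pts_def)
  qed (auto intro!: holomorphic_intros holo_cosh)
  \<comment> \<open>The values of \<open>sinh\<close> at the two poles are \<open>sinh A\<close> and
    \<open>- sinh A\<close>; the opposite signs turn the sum of exponentials into a sine.\<close>
  have "(\<Sum>p\<in>pts. exp (\<i> * b * p) / sinh p) =
      exp (\<i> * b * (\<i> * pi - A)) / sinh A - exp (\<i> * b * (\<i> * pi + A)) / sinh A"
    using A(1) sinh_i_pi_add[of A] sinh_i_pi_add[of "-A"] by (simp add: pts_def)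
  also have "\<dots> = exp (- pi * b) * (exp (- (\<i> * (b * A))) - exp (\<i> * (b * A))) / sinh A"
  proof -
    have "exp (\<i> * b * (\<i> * pi - A)) = exp (- pi * b) * exp (- (\<i> * (b * A)))"
      "exp (\<i> * b * (\<i> * pi + A)) = exp (- pi * b) * exp (\<i> * (b * A))"
      by (simp_all add: algebra_simps flip: exp_add exp_of_real)
    then show ?thesis
      by (simp add: algebra_simps diff_divide_distrib)
  qed
  also have "\<dots> = - 2 * \<i> * sin (b * A) * exp (- pi * b) / sinh A"
  proof -
    have "exp (- (\<i> * (b * A))) - exp (\<i> * (b * A)) = - 2 * \<i> * sin (b * A)"
      by (simp add: sin_exp_eq)
    then show ?thesis
      by (simp only: mult_ac)
  qed
  finally have sum: "2 * pi * \<i> * (\<Sum>p\<in>pts. exp (\<i> * b * p) / sinh p) = C"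
    by (simp add: C_def algebra_simps)
  have contour: "(f has_contour_integral C) (rectpath (Complex (-R) 0) (Complex R (2 * pi)))"
    if R: "r \<le> R" for R
  proof -
    let ?g = "rectpath (Complex (-R) 0) (Complex R (2 * pi))"
    have ReA: "\<bar>Re A\<bar> < R"
      using R norm_ge_zero[of "cosh A"] unfolding r_def by linarith
    then have "R > 0"
      by linarith
    have box: "pts \<subseteq> box (Complex (-R) 0) (Complex R (2 * pi))"
      using ReA A(2) by (auto simp: pts_def in_box_complex_iff)
    have cboxS: "cbox (Complex (-R) 0) (Complex R (2 * pi)) \<subseteq> S"
      using A(2) by (auto simp: in_cbox_complex_iff S_def)
    have img: "path_image ?g \<subseteq> S - pts"
      using box cboxS \<open>R > 0\<close> by (subst path_image_rectpath_cbox_minus_box) auto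
    have "contour_integral ?g f = 2 * pi * \<i> * (\<Sum>p\<in>pts. winding_number ?g p * residue f p)"
    proof (rule Residue_theorem[OF \<open>open S\<close> convex_connected[OF \<open>convex S\<close>] _ holo _ _ img])
      show "\<forall>z. z \<notin> S \<longrightarrow> winding_number ?g z = 0"
        using cboxS \<open>R > 0\<close> by (auto intro!: winding_number_rectpath_outside)
    qed (auto simp: pts_def)
    also have "\<dots> = C"
      using box by (subst sum[symmetric]) (auto intro!: sum.cong simp: res winding_number_rectpath)
    finally have "contour_integral ?g f = C" .
    moreover have "f contour_integrable_on ?g"
      using holo img \<open>open S\<close>
      by (intro contour_integrable_holomorphic_simple[of _ "S - pts"]) (auto simp: pts_def intro: open_Diff finite_imp_closed)
    ultimately show ?thesis
      using has_contour_integral_integral by metis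
  qed
  have bound: "norm (f z) \<le> B \<bar>Re z\<bar>" if z: "0 \<le> Im z" "Im z \<le> 2 * pi" "r \<le> \<bar>Re z\<bar>" for z
  proof -
    have "\<bar>Re z\<bar> \<le> sinh \<bar>Re z\<bar>"
      using real_le_x_sinh[of "\<bar>Re z\<bar>"] by (simp add: sinh_field_def exp_minus del: sinh_real_abs)
    then have "norm (cosh A) < sinh \<bar>Re z\<bar>"
      using z(3) unfolding r_def by linarith
    moreover have "sinh \<bar>Re z\<bar> - norm (cosh A) \<le> norm (cosh z + cosh A)"
      using sinh_le_norm_cosh[of z] norm_diff_ineq[of "cosh z" "cosh A"] by linarith
    moreover have "norm (exp (\<i> * b * z)) \<le> exp (2 * pi * \<bar>b\<bar>)"
    proof -
      have "- (b * Im z) \<le> \<bar>b\<bar> * \<bar>Im z\<bar>"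
        by (metis abs_ge_minus_self abs_mult)
      also have "\<dots> \<le> \<bar>b\<bar> * (2 * pi)"
        using z by (intro mult_left_mono) auto
      finally show ?thesis
        by (simp add: norm_exp_eq_Re mult_ac)
    qed
    ultimately show ?thesis
      unfolding f_def B_def norm_divide by (intro frac_le) auto
  qed
  have B: "B \<in> O(\<lambda>x. 1 / x\<^sup>2)"
    unfolding B_def sinh_field_def by real_asymp
  have line: "complex_of_real x \<in> S - pts" "complex_of_real x + \<i> * (2 * pi) \<in> S - pts" for x
    using A(2) by (auto simp: S_def pts_def complex_eq_iff)
  have "continuous_on (S - pts) f"
    using holo by (rule holomorphic_on_imp_continuous_on)
  then have cont: "continuous_on UNIV (\<lambda>x::real. f x)" "continuous_on UNIV (\<lambda>x::real. f (x + \<i> * of_real (2 * pi)))"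
    using line by (auto intro!: continuous_on_compose2[of "S - pts" f] continuous_intros)
  note lines = integral_horizontal_lines_diff[of "2 * pi" r f C B, OF _ contour bound B cont]
  show "integrable lborel (\<lambda>x::real. f x)"
    using lines(1) by simp
  have "f (x + \<i> * (2 * pi)) = exp (- (2 * pi * b)) * f x" for x
  proof -
    have "cosh (x + \<i> * (2 * pi)) = cosh x"
    proof -
      have "x + \<i> * (2 * pi) = \<i> * pi + (\<i> * pi + x)"
        by (simp add: algebra_simps)
      then show ?thesis
        by (simp only: cosh_i_pi_add minus_minus)
    qed
    moreover have "exp (\<i> * b * (x + \<i> * (2 * pi))) = exp (- (2 * pi * b)) * exp (\<i> * b * x)"
    proof -
      have "\<i> * b * (x + \<i> * (2 * pi)) = complex_of_real (- (2 * pi * b)) + \<i> * b * x"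
        by (simp add: algebra_simps)
      then show ?thesis
        by (simp only: exp_add exp_of_real)
    qed
    ultimately show ?thesis
      by (simp add: f_def)
  qed
  then have "(LINT x|lborel. f (complex_of_real x)) * (1 - exp (- (2 * pi * b))) = C"
    using lines(3) by (simp add: algebra_simps)
  \<comment> \<open>Splitting off \<open>exp (- (pi * b))\<close> matches the same factor in
    \<open>C\<close>, leaving only \<open>sinh (pi * b)\<close>.\<close>
  moreover have "1 - exp (- (2 * pi * b)) = 2 * complex_of_real (sinh (pi * b)) * exp (- (pi * b))"
  proof -
    have "1 - exp (- (2 * (pi * b))) = 2 * sinh (pi * b) * exp (- (pi * b))"
    proof -
      have "exp (- (2 * (pi * b))) = exp (- (pi * b)) * exp (- (pi * b))"
        "exp (pi * b) * exp (- (pi * b)) = 1"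
        by (simp_all flip: exp_add)
      then show ?thesis
        by (simp add: sinh_field_def left_diff_distrib)
    qed
    from arg_cong[OF this, of complex_of_real] show ?thesis
      by (simp add: mult.assoc)
  qed
  ultimately have "(LINT x|lborel. f (complex_of_real x)) *
      (2 * complex_of_real (sinh (pi * b)) * exp (- (pi * b))) = C"
    by simp
  from arg_cong[OF this, of "\<lambda>u. u * sinh A"]
  have "(LINT x|lborel. f (complex_of_real x)) * (sinh A * sinh (pi * b)) * (2 * exp (- (pi * b))) = C * sinh A"
    by (simp add: mult_ac)
  also have "\<dots> = 2 * pi * sin (b * A) * (2 * exp (- (pi * b)))"
    using sinhA by (simp add: C_def)
  finally have "(LINT x|lborel. f (complex_of_real x)) * (sinh A * sinh (pi * b)) = 2 * pi * sin (b * A)"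
    by (simp add: mult_ac)
  moreover have "sinh (pi * b) \<noteq> 0"
    using b by simp
  ultimately show "(LINT x|lborel. f (complex_of_real x)) = 2 * pi * sin (b * A) / (sinh A * sinh (pi * b))"
    using sinhA by (simp add: nonzero_eq_divide_eq)
qed

lemma sinh_of_real: "sinh (of_real x :: 'a :: {real_normed_field, banach}) = of_real (sinh x)"
  and cosh_of_real: "cosh (of_real x :: 'a :: {real_normed_field, banach}) = of_real (cosh x)"
  by (simp_all add: sinh_field_def cosh_field_def flip: exp_of_real)

text \<open>The special case \<open>A = i pi / 2\<close>, where \<open>cosh A = 0\<close>.\<close>
lemma integral_cos_over_cosh:
  fixes t :: real
  assumes "t \<noteq> 0"
  shows "(LINT x|lborel. cos (t * x) / cosh x) = pi / cosh (pi * t / 2)"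
proof -
  let ?A = "\<i> * complex_of_real (pi / 2)"
  let ?f = "\<lambda>x. exp (\<i> * t * complex_of_real x) / (cosh (complex_of_real x) + cosh ?A)"
  have A: "?A \<noteq> 0" "\<bar>Im ?A\<bar> < pi"
    by auto
  have coshA: "cosh ?A = 0" and sinhA: "sinh ?A = \<i>"
    unfolding cosh_i_times sinh_i_times by simp_all
  have "\<i> * (t * ?A) = complex_of_real (- (pi * t / 2))"
    by (simp add: field_simps)
  \<comment> \<open>The factor \<open>i\<close> here cancels against \<open>sinh ?A = i\<close>, so
    the value of the integral is real.\<close>
  then have sinA: "sin (t * ?A) = \<i> * sinh (pi * t / 2)"
    unfolding sin_conv_sinh by (simp only: sinh_of_real sinh_minus of_real_minus) simp
  have Re_f: "Re (?f x) = cos (t * x) / cosh x" for x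
  proof -
    have "?f x = cis (t * x) / complex_of_real (cosh x)"
      unfolding coshA by (simp add: cis_conv_exp mult.assoc cosh_of_real)
    then show ?thesis
      by simp
  qed
  have "(LINT x|lborel. cos (t * x) / cosh x) = (LINT x|lborel. Re (?f x))"
    by (simp only: Re_f)
  also have "\<dots> = Re (LINT x|lborel. ?f x)"
    using fourier_integral_inverse_cosh_add_cosh(1)[OF A assms] by (rule integral_Re)
  also have "\<dots> = 2 * pi * sinh (pi * t / 2) / sinh (pi * t)"
    unfolding fourier_integral_inverse_cosh_add_cosh(2)[OF A assms] sinA sinhA
    by (simp add: Re_divide_of_real)
  \<comment> \<open>The factor \<open>sinh (pi * t / 2)\<close>, nonzero because
    \<open>t \<noteq> 0\<close>, cancels against the numerator.\<close>
  also have "sinh (pi * t) = 2 * sinh (pi * t / 2) * cosh (pi * t / 2)"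
    using sinh_double[of "pi * t / 2"] by simp
  finally show ?thesis
    using assms by simp
qed

section \<open>The sine integral of \<open>1 / sinh x\<close>\<close>

lemma norm_sin_le: "norm (sin (z :: complex)) \<le> exp \<bar>Im z\<bar>"
proof -
  have "norm (sin z) \<le> (norm (exp (\<i> * z)) + norm (exp (- (\<i> * z)))) / 2"
    unfolding sin_exp_eq using norm_triangle_ineq4[of "exp (\<i> * z)" "exp (- (\<i> * z))"]
    by (simp add: norm_divide norm_mult)
  also have "\<dots> \<le> exp \<bar>Im z\<bar>"
  proof -
    have "exp (- Im z) \<le> exp \<bar>Im z\<bar>" "exp (Im z) \<le> exp \<bar>Im z\<bar>"
      by simp_all
    then have "exp (- Im z) + exp (Im z) \<le> 2 * exp \<bar>Im z\<bar>"
      by linarith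
    then show ?thesis
      by (simp add: norm_exp_eq_Re)
  qed
  finally show ?thesis .
qed

text \<open>Numerator and denominator vanish at 0 with derivatives \<open>c\<close> and 1. The limit
  is the value that removes the singularity on the real line.\<close>

lemma tendsto_sin_over_sinh_0: "((\<lambda>z. sin (c * z) / sinh z) \<longlongrightarrow> c) (at 0)"
  for c :: "'a :: {real_normed_field, banach}"
proof -
  have "((\<lambda>z. sin (c * z)) has_field_derivative c) (at 0)"
    "((sinh :: 'a \<Rightarrow> 'a) has_field_derivative 1) (at 0)"
    by (auto intro!: derivative_eq_intros)
  then have "((\<lambda>z. sin (c * z) / z) \<longlongrightarrow> c) (at 0)" "((\<lambda>z. sinh z / z) \<longlongrightarrow> (1 :: 'a)) (at 0)"
    by (simp_all add: has_field_derivative_iff)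
  from tendsto_divide[OF this] have "((\<lambda>z. sin (c * z) / z / (sinh z / z)) \<longlongrightarrow> c) (at 0)"
    by simp
  moreover have "\<forall>\<^sub>F z in at 0. sin (c * z) / z / (sinh z / z) = sin (c * z) / sinh z"
    by (simp add: eventually_at_filter)
  ultimately show ?thesis
    using tendsto_cong by fast
qed

text \<open>
  On the line \<open>Im z = pi / 2\<close> the function \<open>sinh\<close> becomes \<open>i cosh\<close>, so that shifting the contour reduces
  the integral to the previous one, without meeting any pole.
\<close>
lemma integrable_sin_over_sinh: "integrable lborel (\<lambda>x. sin (t * x) / sinh x)"
  and integral_sin_over_sinh: "(LINT x|lborel. sin (t * x) / sinh x) = pi * tanh (pi * t / 2)"
  for t :: real
proof -
  \<comment> \<open>Filling in the limit at 0 lets the lower side of the rectangle run through the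
    removable singularity.\<close>
  define g where "g z = (if z = 0 then complex_of_real t else sin (t * z) / sinh z)" for z :: complex
  define S where "S = {z. \<bar>Im z\<bar> < pi}"
  define B where "B u = exp (\<bar>t\<bar> * pi / 2) / sinh u" for u :: real
  have S: "S = {z. Im z < pi} \<inter> {z. Im z > - pi}"
    by (auto simp: S_def)
  have "open S" "convex S"
    unfolding S by (intro open_Int open_halfspace_Im_lt open_halfspace_Im_gt convex_Int
        convex_halfspace_Im_lt convex_halfspace_Im_gt)+
  have nz: "sinh z \<noteq> 0" if "z \<in> S - {0}" for z
  proof
    assume "sinh z = 0"
    then obtain n :: int where n: "z = \<i> * (of_int n * pi)"
      by (rule sinh_eq_0_imp)
    then have "\<bar>real_of_int n\<bar> * pi < 1 * pi"
      using that by (simp add: abs_mult S_def)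
    then have "n = 0"
      by (subst (asm) mult_less_cancel_right_pos) auto
    with n that show False by simp
  qed
  have holo: "g holomorphic_on S - {0}"
  proof (rule holomorphic_transform)
    have "(\<lambda>z. sinh z) holomorphic_on S - {0}"
      unfolding sinh_field_def by (intro holomorphic_intros) auto
    then show "(\<lambda>z. sin (t * z) / sinh z) holomorphic_on S - {0}"
      using nz by (intro holomorphic_intros) auto
  qed (auto simp: g_def)
  have diff: "g field_differentiable at z" if "z \<in> S - {0}" for z
    using holo that \<open>open S\<close> by (auto intro: holomorphic_on_imp_differentiable_at open_Diff)
  have cont: "continuous_on S g"
  proof (rule continuous_at_imp_continuous_on, rule ballI)
    fix z assume "z \<in> S"
    show "isCont g z"
    proof (cases "z = 0")
      case True
      have "\<forall>\<^sub>F z in at (0 :: complex). sin (t * z) / sinh z = g z"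
        by (simp add: eventually_at_filter g_def)
      then have "(g \<longlongrightarrow> t) (at 0)"
        using tendsto_cong tendsto_sin_over_sinh_0[of "complex_of_real t"] by fast
      with True show ?thesis
        by (simp add: isCont_def g_def)
    next
      case False
      with diff[of z] \<open>z \<in> S\<close> show ?thesis
        by (auto intro: field_differentiable_imp_continuous_at)
    qed
  qed
  \<comment> \<open>This form of Cauchy's theorem asks only for continuity at the exceptional point
    0.\<close>
  have contour: "(g has_contour_integral 0) (rectpath (Complex (-R) 0) (Complex R (pi / 2)))" if "1 \<le> R" for R
  proof (rule Cauchy_theorem_convex[OF cont \<open>convex S\<close>, of "{0}"])
    have "cbox (Complex (-R) 0) (Complex R (pi / 2)) \<subseteq> S"
      by (auto simp: in_cbox_complex_iff S_def abs_if intro: order_le_less_trans[of _ "pi / 2"])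
    then show "path_image (rectpath (Complex (-R) 0) (Complex R (pi / 2))) \<subseteq> S"
      using path_image_rectpath_subset_cbox[of "Complex (-R) 0" "Complex R (pi / 2)"] that by auto
  qed (use diff in \<open>auto dest: interior_subset[THEN subsetD]\<close>)
  have bound: "norm (g z) \<le> B \<bar>Re z\<bar>" if z: "0 \<le> Im z" "Im z \<le> pi / 2" "1 \<le> \<bar>Re z\<bar>" for z
  proof -
    have "norm (sin (t * z)) \<le> exp \<bar>t * Im z\<bar>"
      using norm_sin_le[of "t * z"] by simp
    also have "\<dots> \<le> exp (\<bar>t\<bar> * pi / 2)"
      using z mult_left_mono[of "Im z" "pi / 2" "\<bar>t\<bar>"] by (simp add: abs_mult)
    finally have "norm (sin (t * z)) \<le> exp (\<bar>t\<bar> * pi / 2)" .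
    moreover have "0 < sinh \<bar>Re z\<bar>"
      using z by (subst sinh_real_pos_iff) simp
    moreover have "z \<noteq> 0"
      using z by auto
    ultimately show ?thesis
      using sinh_le_norm_sinh[of z] by (auto simp: g_def B_def norm_divide intro!: frac_le)
  qed
  have B: "B \<in> O(\<lambda>x. 1 / x\<^sup>2)"
    unfolding B_def sinh_field_def by real_asymp
  have "complex_of_real x \<in> S" "complex_of_real x + \<i> * of_real (pi / 2) \<in> S" for x
    by (auto simp: S_def)
  then have cont_lines: "continuous_on UNIV (\<lambda>x::real. g x)"
      "continuous_on UNIV (\<lambda>x::real. g (x + \<i> * of_real (pi / 2)))"
    by (auto intro!: continuous_on_compose2[OF cont] continuous_intros)
  note lines = integral_horizontal_lines_diff[of "pi / 2" 1 g 0 B, OF _ contour bound B cont_lines]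
  have bottom: "Re (g (complex_of_real x)) = (if x = 0 then t else sin (t * x) / sinh x)" for x
    by (simp add: g_def sinh_of_real sin_of_real Re_divide_of_real flip: of_real_mult)
  \<comment> \<open>The denominator is \<open>i cosh x\<close>, so the summand of the sine with
    \<open>cosh (pi * t / 2)\<close> becomes purely imaginary; taking real parts discards
    it.\<close>
  have top: "Re (g (x + \<i> * of_real (pi / 2))) = sinh (pi * t / 2) * (cos (t * x) / cosh x)" for x :: real
  proof -
    have "sinh (x + \<i> * of_real (pi / 2)) = \<i> * of_real (cosh x)"
      unfolding sinh_add cosh_i_times sinh_i_times by (simp add: cosh_of_real)
    moreover have "sin (t * (x + \<i> * of_real (pi / 2))) =
        sin (t * x) * cosh (pi * t / 2) + \<i> * (cos (t * x) * sinh (pi * t / 2))"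
    proof -
      have "\<i> * (\<i> * (pi * t / 2)) = complex_of_real (- (pi * t / 2))"
        by simp
      then have "cos (\<i> * (pi * t / 2)) = cosh (pi * t / 2)" "sin (\<i> * (pi * t / 2)) = \<i> * sinh (pi * t / 2)"
        unfolding cos_conv_cosh sin_conv_sinh
        by (simp_all only: cosh_of_real sinh_of_real cosh_minus sinh_minus of_real_minus) simp_all
      moreover have "t * (x + \<i> * of_real (pi / 2)) = complex_of_real (t * x) + \<i> * (pi * t / 2)"
        by (simp add: algebra_simps)
      ultimately show ?thesis
        by (simp only: sin_add sin_of_real cos_of_real) simp
    qed
    moreover have "x + \<i> * of_real (pi / 2) \<noteq> 0"
      by (simp add: complex_eq_iff)
    ultimately show ?thesis
      by (simp add: g_def Re_divide power2_eq_square)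
  qed
  have int: "integrable lborel (\<lambda>x. if x = 0 then t else sin (t * x) / sinh x)"
    using integrable_Re[OF lines(1)] by (simp add: bottom)
  then show "integrable lborel (\<lambda>x. sin (t * x) / sinh x)"
    by (rule integrable_discrete_difference[where X="{0}", THEN iffD1, rotated 4]) auto
  have "(LINT x|lborel. sin (t * x) / sinh x) = (LINT x|lborel. (if x = 0 then t else sin (t * x) / sinh x))"
    by (rule integral_discrete_difference[where X="{0}"]) auto
  also have "\<dots> = (LINT x|lborel. Re (g (complex_of_real x)))"
    by (simp add: bottom)
  also have "\<dots> = Re (LINT x|lborel. g (complex_of_real x))"
    using lines(1) by (intro integral_Re) simp
  also have "(LINT x|lborel. g (complex_of_real x)) = (LINT x|lborel. g (complex_of_real x + \<i> * of_real (pi / 2)))"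
    using lines(3) by simp
  also have "Re (LINT x|lborel. g (complex_of_real x + \<i> * of_real (pi / 2))) = (LINT x|lborel. Re (g (complex_of_real x + \<i> * of_real (pi / 2))))"
    using lines(2) by (intro integral_Re[symmetric]) simp
  also have "\<dots> = sinh (pi * t / 2) * (LINT x|lborel. cos (t * x) / cosh x)"
    by (simp only: top integral_mult_right_zero)
  \<comment> \<open>For \<open>t = 0\<close> both sides vanish; otherwise the cosine integral is
    known.\<close>
  also have "\<dots> = pi * tanh (pi * t / 2)"
    by (cases "t = 0") (simp_all add: integral_cos_over_cosh tanh_def)
  finally show "(LINT x|lborel. sin (t * x) / sinh x) = pi * tanh (pi * t / 2)" .
qed

section \<open>The double integral\<close>

text \<open>As \<open>k \<ge> 0\<close>, the quotient is at most \<open>1 / cosh (c * x)\<close>.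
  The case \<open>k = cosh (c * a)\<close> gives the reduced integrand, \<open>k = 0\<close> the
  majorants for convergence arguments.\<close>

lemma integrable_bounded_over_cosh:
  fixes f :: "real \<Rightarrow> real"
  assumes "0 < c" "0 \<le> k" "continuous_on UNIV f" "\<And>x. \<bar>f x\<bar> \<le> 1"
  shows "integrable lborel (\<lambda>x. f x / (cosh (c * x) + k))"
proof (rule integrable_of_inverse_square_decay[of _ 0 "\<lambda>x. 1 / cosh (c * x)"])
  have pos: "0 < cosh (c * x) + k" for x
    using assms(2) by (intro add_pos_nonneg) auto
  then have nz: "cosh (c * x) + k \<noteq> 0" for x
    by (metis less_irrefl)
  show "continuous_on UNIV (\<lambda>x. f x / (cosh (c * x) + k))"
    using nz by (intro continuous_intros assms(3)) auto
  show "norm (f x / (cosh (c * x) + k)) \<le> 1 / cosh (c * \<bar>x\<bar>)" for x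
  proof -
    have "cosh (c * \<bar>x\<bar>) = cosh (c * x)"
      by (cases "x \<ge> 0") simp_all
    moreover have "norm (f x / (cosh (c * x) + k)) = \<bar>f x\<bar> / (cosh (c * x) + k)"
      by (simp only: real_norm_def abs_divide abs_of_pos[OF pos])
    moreover have "\<bar>f x\<bar> / (cosh (c * x) + k) \<le> 1 / cosh (c * x)"
      using assms(2,4) by (intro frac_le) auto
    ultimately show ?thesis
      by (simp only:)
  qed
  show "(\<lambda>x. 1 / cosh (c * x)) \<in> O(\<lambda>x. 1 / x\<^sup>2)"
    unfolding cosh_field_def using \<open>0 < c\<close> by real_asymp
qed

lemma interval_integral_0_infty_even:
  fixes f :: "real \<Rightarrow> real"
  assumes f: "integrable lborel f" and even: "\<And>x. f (- x) = f x"
  shows "(LBINT x=0..\<infinity>. f x) = (LINT x|lborel. f x) / 2"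
proof -
  have "integrable lborel (\<lambda>x. indicator {0..} x *\<^sub>R f x)"
    using f by (intro integrable_mult_indicator) auto
  then have "has_bochner_integral lborel (\<lambda>x. indicator {0..} x *\<^sub>R f x) (LINT x:{0..}|lborel. f x)"
    by (simp add: has_bochner_integral_iff set_lebesgue_integral_def)
  from has_bochner_integral_even_function[OF this even]
  have "(LINT x|lborel. f x) = 2 * (LINT x:{0..}|lborel. f x)"
    by (simp add: has_bochner_integral_iff)
  \<comment> \<open>The interval integral omits the endpoint 0, which the rule for even functions
    includes.\<close>
  moreover have "(LINT x:{0<..}|lborel. f x) = (LINT x:{0..}|lborel. f x)"
    by (rule set_integral_discrete_difference[of "{0}"]) auto
  ultimately show ?thesis
    by (simp add: interval_lebesgue_integral_0_infty)
qed

text \<open>The real part of the complex Fourier integral at frequency \<open>b / c\<close>,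
  followed by the substitution of \<open>c * x\<close> for \<open>x\<close>.\<close>

lemma integral_cos_over_cosh_add_cosh:
  fixes A b c :: real
  assumes "A \<noteq> 0" "b \<noteq> 0" "0 < c"
  shows "(LINT x|lborel. cos (b * x) / (cosh (c * x) + cosh A)) =
    2 * pi / c * sin (b * A / c) / (sinh A * sinh (pi * b / c))"
proof -
  let ?t = "b / c"
  let ?f = "\<lambda>x. exp (\<i> * ?t * complex_of_real x) / (cosh (complex_of_real x) + cosh (complex_of_real A))"
  have A: "complex_of_real A \<noteq> 0" "\<bar>Im (complex_of_real A)\<bar> < pi" and t: "?t \<noteq> 0"
    using assms by auto
  have Re_f: "Re (?f x) = cos (?t * x) / (cosh x + cosh A)" for x
  proof -
    have "?f x = cis (?t * x) / complex_of_real (cosh x + cosh A)"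
      by (simp add: cis_conv_exp mult.assoc cosh_of_real)
    then show ?thesis
      by (simp only: Re_divide_of_real cis.simps)
  qed
  have "(LINT x|lborel. cos (?t * x) / (cosh x + cosh A)) = (LINT x|lborel. Re (?f x))"
    by (simp only: Re_f)
  also have "\<dots> = Re (LINT x|lborel. ?f x)"
    using fourier_integral_inverse_cosh_add_cosh(1)[OF A t] by (rule integral_Re)
  also have "\<dots> = Re (complex_of_real (2 * pi * sin (?t * A) / (sinh A * sinh (pi * ?t))))"
  proof -
    have sin: "sin (complex_of_real ?t * complex_of_real A) = complex_of_real (sin (?t * A))"
      by (simp only: sin_of_real flip: of_real_mult)
    show ?thesis
      unfolding fourier_integral_inverse_cosh_add_cosh(2)[OF A t] sin sinh_of_real
      by (simp only: of_real_mult of_real_divide)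
  qed
  finally have eq: "(LINT x|lborel. cos (?t * x) / (cosh x + cosh A)) =
      2 * pi * sin (?t * A) / (sinh A * sinh (pi * ?t))"
    by simp
  have "(LINT x|lborel. cos (?t * x) / (cosh x + cosh A)) =
      c * (LINT x|lborel. cos (b * x) / (cosh (c * x) + cosh A))"
    using assms(3) by (subst lborel_integral_real_affine[of c _ 0]) simp_all
  with eq have "(LINT x|lborel. cos (b * x) / (cosh (c * x) + cosh A)) * c =
      2 * pi * sin (?t * A) / (sinh A * sinh (pi * ?t))"
    by (simp only: mult.commute)
  then have "(LINT x|lborel. cos (b * x) / (cosh (c * x) + cosh A)) =
      2 * pi * sin (?t * A) / (sinh A * sinh (pi * ?t)) / c"
    by (rule eq_divide_imp[rotated]) (use assms(3) in simp)
  then show ?thesis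
    by (simp add: mult_ac)
qed

lemma integrable_sin_over_sinh_scaled: "0 < c \<Longrightarrow> integrable lborel (\<lambda>x. sin (t * x) / sinh (c * x))"
  and integral_sin_over_sinh_scaled:
    "0 < c \<Longrightarrow> (LINT x|lborel. sin (t * x) / sinh (c * x)) = pi / c * tanh (pi * t / (2 * c))"
  for t c :: real
proof -
  assume c: "0 < c"
  show "integrable lborel (\<lambda>x. sin (t * x) / sinh (c * x))"
    using lborel_integrable_real_affine[OF integrable_sin_over_sinh[of "t / c"], of c 0] c by simp
  have "(LINT x|lborel. sin (t / c * x) / sinh x) = c * (LINT x|lborel. sin (t * x) / sinh (c * x))"
    using c by (subst lborel_integral_real_affine[of c _ 0]) simp_all
  then have "c * (LINT x|lborel. sin (t * x) / sinh (c * x)) = pi * tanh (pi * t / (2 * c))"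
    using integral_sin_over_sinh[of "t / c"] by (simp add: mult.commute)
  then show "(LINT x|lborel. sin (t * x) / sinh (c * x)) = pi / c * tanh (pi * t / (2 * c))"
    using c by (simp add: field_simps)
qed

text \<open>The integrand is even, and a product formula splits it into sines of frequency
  \<open>y + a\<close> and \<open>y - a\<close>. The resulting sum of \<open>tanh ?P\<close> and
  \<open>tanh ?Q\<close> equals \<open>sinh (?P + ?Q) / (cosh ?P * cosh ?Q)\<close>, where
  \<open>a\<close> drops out of \<open>?P + ?Q\<close>.\<close>

lemma interval_integral_sin_cos_over_sinh:
  fixes a y c :: real
  assumes c: "0 < c"
  shows "(LBINT x=0..\<infinity>. sin (y * x) * cos (a * x) / sinh (c * x)) =
    pi / (2 * c) * sinh (pi * y / c) / (cosh (pi * y / c) + cosh (pi * a / c))"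
proof -
  let ?P = "pi * (y + a) / (2 * c)" and ?Q = "pi * (y - a) / (2 * c)"
  have eq: "sin (y * x) * cos (a * x) / sinh (c * x) =
      (sin ((y + a) * x) / sinh (c * x) + sin ((y - a) * x) / sinh (c * x)) / 2" for x
    unfolding sin_times_cos by (simp add: distrib_right left_diff_distrib add_divide_distrib)
  note int = integrable_sin_over_sinh_scaled[OF c]
  have "(LBINT x=0..\<infinity>. sin (y * x) * cos (a * x) / sinh (c * x)) =
      (LINT x|lborel. sin (y * x) * cos (a * x) / sinh (c * x)) / 2"
  proof (rule interval_integral_0_infty_even)
    show "integrable lborel (\<lambda>x. sin (y * x) * cos (a * x) / sinh (c * x))"
      unfolding eq by (intro integrable_divide_zero Bochner_Integration.integrable_add int)
  qed simp
  also have "(LINT x|lborel. sin (y * x) * cos (a * x) / sinh (c * x)) =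
      (pi / c * tanh ?P + pi / c * tanh ?Q) / 2"
    unfolding eq by (simp only: integral_divide_zero Bochner_Integration.integral_add[OF int int]
        integral_sin_over_sinh_scaled[OF c])
  also have "\<dots> / 2 = pi / (4 * c) * (tanh ?P + tanh ?Q)"
    by (simp add: distrib_left add_divide_distrib)
  also have "tanh ?P + tanh ?Q = sinh (?P + ?Q) / (cosh ?P * cosh ?Q)"
    by (simp add: tanh_def sinh_add field_simps)
  also have "?P + ?Q = pi * y / c"
    using c by (simp add: field_simps)
  also have "cosh ?P * cosh ?Q = (cosh (pi * y / c) + cosh (pi * a / c)) / 2"
  proof -
    have "(pi * y / c + pi * a / c) / 2 = ?P" "(pi * y / c - pi * a / c) / 2 = ?Q"
      using c by (simp_all add: field_simps)
    then show ?thesis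
      by (simp add: cosh_add_cosh[of "pi * y / c"] mult.commute)
  qed
  finally show ?thesis
    by simp
qed

section \<open>The transform of the kernel\<close>

text \<open>The scale \<open>c = sqrt pi\<close> is the positive solution of
  \<open>pi / c = c\<close>: the integrals reproduce the hyperbolic frequency of the kernel, which
  makes it self-dual.\<close>

lemma pi_div_sqrt_pi: "pi * x / sqrt pi = sqrt pi * x" "pi / (2 * sqrt pi) = sqrt pi / 2"
  using real_div_sqrt[of pi] by (simp_all add: field_simps)

lemma cos_transform2_hyp_kernel:
  "cos_transform2 hyp_kernel a b =
    sqrt pi / (2 * pi) * (LINT y|lborel. cos (b * y) / (cosh (sqrt pi * y) + cosh (sqrt pi * a)))"
proof -
  let ?c = "sqrt pi"
  have c: "0 < ?c"
    by simp
  \<comment> \<open>Positivity of \<open>y\<close> allows \<open>sinh (?c * y)\<close> to be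
    cancelled; the outer integral only sees such \<open>y\<close>.\<close>
  have inner: "(LBINT x=0..\<infinity>. hyp_kernel x y * cos (a * x) * cos (b * y)) =
      ?c / 2 * (cos (b * y) / (cosh (?c * y) + cosh (?c * a)))" if "0 < y" for y
  proof -
    have "(LBINT x=0..\<infinity>. hyp_kernel x y * cos (a * x) * cos (b * y)) =
        (LBINT x=0..\<infinity>. cos (b * y) / sinh (?c * y) * (sin (y * x) * cos (a * x) / sinh (?c * x)))"
      by (simp add: hyp_kernel_def mult_ac)
    also have "\<dots> = cos (b * y) / sinh (?c * y) * (LBINT x=0..\<infinity>. sin (y * x) * cos (a * x) / sinh (?c * x))"
      by (rule interval_lebesgue_integral_mult_right)
    also have "\<dots> = cos (b * y) / sinh (?c * y) * (?c / 2 * sinh (?c * y) / (cosh (?c * y) + cosh (?c * a)))"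
      unfolding interval_integral_sin_cos_over_sinh[OF c] pi_div_sqrt_pi ..
    finally show ?thesis
      using that by simp
  qed
  have "cos_transform2 hyp_kernel a b =
      2 / pi * (LBINT y=0..\<infinity>. ?c / 2 * (cos (b * y) / (cosh (?c * y) + cosh (?c * a))))"
    unfolding cos_transform2_def
  proof (intro arg_cong2[of _ _ _ _ "(*)"] refl interval_integral_cong)
    fix y assume "y \<in> einterval (min 0 \<infinity>) (max 0 \<infinity>)"
    then have "0 < y"
      by (simp add: einterval_def zero_ereal_def)
    then show "(LBINT x=0..\<infinity>. hyp_kernel x y * cos (a * x) * cos (b * y)) =
        ?c / 2 * (cos (b * y) / (cosh (?c * y) + cosh (?c * a)))"
      by (rule inner)
  qed
  also have "\<dots> = 2 / pi * (?c / 2 * (LBINT y=0..\<infinity>. cos (b * y) / (cosh (?c * y) + cosh (?c * a))))"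
    by (subst interval_lebesgue_integral_mult_right) simp
  also have "(LBINT y=0..\<infinity>. cos (b * y) / (cosh (?c * y) + cosh (?c * a))) =
      (LINT y|lborel. cos (b * y) / (cosh (?c * y) + cosh (?c * a))) / 2"
    by (intro interval_integral_0_infty_even integrable_bounded_over_cosh continuous_intros) simp_all
  finally show ?thesis
    by simp
qed

lemma cos_transform2_hyp_kernel_eq:
  assumes "a \<noteq> 0" "b \<noteq> 0"
  shows "cos_transform2 hyp_kernel a b = hyp_kernel a b"
proof -
  have "sqrt pi * a \<noteq> 0"
    using assms by simp
  then have "cos_transform2 hyp_kernel a b = sqrt pi / (2 * pi) *
      (2 * pi / sqrt pi * sin (b * (sqrt pi * a) / sqrt pi) /
        (sinh (sqrt pi * a) * sinh (pi * b / sqrt pi)))"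
    unfolding cos_transform2_hyp_kernel
    by (subst integral_cos_over_cosh_add_cosh) (use assms in simp_all)
  moreover have "sqrt pi / (2 * pi) * (2 * pi / sqrt pi * x / y) = x / y" for x y
    by simp
  ultimately have "cos_transform2 hyp_kernel a b =
      sin (b * (sqrt pi * a) / sqrt pi) / (sinh (sqrt pi * a) * sinh (pi * b / sqrt pi))"
    by (simp only:)
  then show ?thesis
    by (simp add: hyp_kernel_def pi_div_sqrt_pi mult.commute)
qed

text \<open>Because \<open>cosh (sqrt pi * a)\<close> is positive,
  \<open>1 / cosh (sqrt pi * y)\<close> dominates the reduced integrand for all parameters at once.
  Continuity carries the formula from the complement of the axes to limits on them.\<close>

lemma isCont_cos_transform2_hyp_kernel:
  "isCont (\<lambda>(a, b). cos_transform2 hyp_kernel a b) (a, b)"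
  unfolding continuous_at_sequentially
proof (intro allI impI)
  fix X :: "nat \<Rightarrow> real \<times> real"
  assume X: "X \<longlonglongrightarrow> (a, b)"
  let ?f = "\<lambda>p y. cos (snd p * y) / (cosh (sqrt pi * y) + cosh (sqrt pi * fst p))"
  have pos: "0 < cosh x + cosh y" for x y :: real
    by (simp add: add_pos_pos)
  have "?f p \<in> borel_measurable borel" for p
    using pos[THEN less_imp_neq] by (intro borel_measurable_continuous_onI continuous_intros) auto
  then have meas: "?f p \<in> borel_measurable lborel" for p
    by simp
  have "(\<lambda>n. LINT y|lborel. ?f (X n) y) \<longlonglongrightarrow> (LINT y|lborel. ?f (a, b) y)"
  proof (rule integral_dominated_convergence[of _ _ _ "\<lambda>y. 1 / cosh (sqrt pi * y)"])
    show "integrable lborel (\<lambda>y. 1 / cosh (sqrt pi * y))"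
      using integrable_bounded_over_cosh[of "sqrt pi" 0 "\<lambda>_. 1"] by simp
    show "AE y in lborel. (\<lambda>n. ?f (X n) y) \<longlonglongrightarrow> ?f (a, b) y"
      using pos[THEN less_imp_neq] by (intro AE_I2 tendsto_intros X) auto
    show "AE y in lborel. norm (?f (X n) y) \<le> 1 / cosh (sqrt pi * y)" for n
    proof (rule AE_I2)
      fix y
      have "norm (?f (X n) y) = \<bar>cos (snd (X n) * y)\<bar> / (cosh (sqrt pi * y) + cosh (sqrt pi * fst (X n)))"
        by (simp add: add_pos_pos)
      also have "\<dots> \<le> 1 / cosh (sqrt pi * y)"
        by (intro frac_le) auto
      finally show "norm (?f (X n) y) \<le> 1 / cosh (sqrt pi * y)" .
    qed
  qed (rule meas)+
  from tendsto_mult_left[OF this, of "sqrt pi / (2 * pi)"]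
  show "((\<lambda>(a, b). cos_transform2 hyp_kernel a b) \<circ> X) \<longlonglongrightarrow> (case (a, b) of (a, b) \<Rightarrow> cos_transform2 hyp_kernel a b)"
    by (simp add: cos_transform2_hyp_kernel case_prod_beta' o_def)
qed

section \<open>Absolute convergence of the double integral\<close>

text \<open>From \<open>\<bar>sin (x * y)\<bar> \<le> x * y\<close> the integrand is bounded by a
  product of a function of \<open>x\<close> and a function of \<open>y\<close>, each with an
  integrable majorant.\<close>

lemma set_integrable_hyp_kernel:
  "set_integrable lborel ({0<..} \<times> {0<..}) (\<lambda>(x, y). hyp_kernel x y * cos (a * x) * cos (b * y))"
proof -
  let ?c = "sqrt pi"
  define h where "h x = 1 / cosh (?c / 2 * x)" for x
  have h: "integrable lborel h"
    unfolding h_def using integrable_bounded_over_cosh[of "?c / 2" 0 "\<lambda>_. 1"] by simp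
  have [measurable]: "h \<in> borel_measurable borel"
    using h by simp
  have h_pos: "0 < h x" for x
    by (simp add: h_def)
  have [measurable]: "(sinh :: real \<Rightarrow> real) \<in> borel_measurable borel"
    by (intro borel_measurable_continuous_onI continuous_intros)
  \<comment> \<open>This is \<open>u \<le> sinh u\<close> at \<open>u = ?c / 2 * x\<close>, combined
    with the doubling formula for \<open>sinh\<close>.\<close>
  have sinh_bound: "?c * x / sinh (?c * x) \<le> h x" if "0 < x" for x
  proof -
    let ?u = "?c / 2 * x"
    have "?u \<le> sinh ?u"
      using real_le_x_sinh[of ?u] that by (simp add: sinh_field_def exp_minus)
    then have "?c * x * cosh ?u \<le> 2 * sinh ?u * cosh ?u"
      by (intro mult_right_mono) auto
    also have "\<dots> = sinh (?c * x)"
      using sinh_double[of ?u] by simp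
    finally show ?thesis
      using that by (simp add: h_def divide_le_eq le_divide_eq mult.commute)
  qed
  have bound: "\<bar>hyp_kernel x y * cos (a * x) * cos (b * y)\<bar> \<le> h x * h y / pi" if "0 < x" "0 < y" for x y
  proof -
    have pos: "0 < sinh (?c * x)" "0 < sinh (?c * y)"
      using that by simp_all
    have "\<bar>cos (a * x)\<bar> * \<bar>cos (b * y)\<bar> \<le> 1 * 1"
      by (intro mult_mono) auto
    then have "\<bar>hyp_kernel x y * cos (a * x) * cos (b * y)\<bar> \<le> \<bar>hyp_kernel x y\<bar> * 1"
      unfolding abs_mult mult.assoc by (intro mult_left_mono) auto
    also have "\<dots> = \<bar>sin (x * y)\<bar> / (sinh (?c * x) * sinh (?c * y))"
      using pos by (simp add: hyp_kernel_def abs_mult)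
    also have "\<dots> \<le> (x * y) / (sinh (?c * x) * sinh (?c * y))"
      using pos that abs_sin_x_le_abs_x[of "x * y"] by (intro divide_right_mono) auto
    \<comment> \<open>Dividing by \<open>pi\<close> compensates for the inserted factor
      \<open>?c * ?c\<close>.\<close>
    also have "\<dots> = (?c * x / sinh (?c * x)) * (?c * y / sinh (?c * y)) / pi"
      by (simp add: field_simps)
    also have "\<dots> \<le> h x * h y / pi"
      using that pos h_pos[of x] by (intro divide_right_mono mult_mono sinh_bound) auto
    finally show ?thesis .
  qed
  have "integrable (lborel \<Otimes>\<^sub>M lborel) (\<lambda>p. h (fst p) * h (snd p) / pi)"
  proof (rule lborel_pair.Fubini_integrable)
    show "integrable lborel (\<lambda>x. LINT y|lborel. norm (h (fst (x, y)) * h (snd (x, y)) / pi))"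
      using h by (simp add: abs_mult)
    show "AE x in lborel. integrable lborel (\<lambda>y. h (fst (x, y)) * h (snd (x, y)) / pi)"
      using h by simp
  qed measurable
  then have "integrable lborel (\<lambda>p. h (fst p) * h (snd p) / pi)"
    by (simp add: lborel_prod)
  then show ?thesis
    unfolding set_integrable_def
  proof (rule Bochner_Integration.integrable_bound)
    have "(\<lambda>p. indicator ({0<..} \<times> {0<..}) p *\<^sub>R (case p of (x, y) \<Rightarrow> hyp_kernel x y * cos (a * x) * cos (b * y)))
        \<in> borel_measurable (lborel \<Otimes>\<^sub>M lborel :: (real \<times> real) measure)"
      unfolding hyp_kernel_def by measurable
    then show "(\<lambda>p. indicator ({0<..} \<times> {0<..}) p *\<^sub>R (case p of (x, y) \<Rightarrow> hyp_kernel x y * cos (a * x) * cos (b * y)))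
        \<in> borel_measurable (lborel :: (real \<times> real) measure)"
      by (simp add: lborel_prod)
    show "AE p in lborel. norm (indicator ({0<..} \<times> {0<..}) p *\<^sub>R (case p of (x, y) \<Rightarrow> hyp_kernel x y * cos (a * x) * cos (b * y)))
        \<le> norm (h (fst p) * h (snd p) / pi)"
    proof (rule AE_I2)
      fix p :: "real \<times> real"
      obtain x y where p: "p = (x, y)"
        by (cases p)
      have "norm (h x * h y / pi) = h x * h y / pi"
        using h_pos[of x] h_pos[of y] by simp
      then show "norm (indicator ({0<..} \<times> {0<..}) p *\<^sub>R (case p of (x, y) \<Rightarrow> hyp_kernel x y * cos (a * x) * cos (b * y)))
          \<le> norm (h (fst p) * h (snd p) / pi)"
        using bound[of x y] by (cases "0 < x \<and> 0 < y") (simp_all add: p)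
    qed
  qed
qed

text \<open>On the axes the quotient defining \<open>hyp_kernel\<close> is \<open>0 / 0\<close>,
  which evaluates to 0, so the limiting value is expressed by a limit through points off both axes.
  Integrability over the open quadrant makes the iterated integral a genuine double
  integral.\<close>

theorem mainTheorem6:
  fixes a b :: real
  shows "set_integrable lborel ({0<..} \<times> {0<..})
           (\<lambda>(x, y). hyp_kernel x y * cos (a * x) * cos (b * y)) \<and>
         (a \<noteq> 0 \<and> b \<noteq> 0 \<longrightarrow> cos_transform2 hyp_kernel a b = hyp_kernel a b) \<and>
         (a = 0 \<or> b = 0 \<longrightarrow>
           ((\<lambda>(u, v). hyp_kernel u v) \<longlongrightarrow> cos_transform2 hyp_kernel a b)
             (at (a, b) within {(u, v). u \<noteq> 0 \<and> v \<noteq> 0}))"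
proof (intro conjI impI)
  have "((\<lambda>(u, v). cos_transform2 hyp_kernel u v) \<longlongrightarrow> cos_transform2 hyp_kernel a b)
      (at (a, b) within {(u, v). u \<noteq> 0 \<and> v \<noteq> 0})"
    using isCont_cos_transform2_hyp_kernel[of a b] by (simp add: isCont_def tendsto_within_subset[of _ _ _ UNIV])
  \<comment> \<open>Off the axes the kernel is its own transform, so it inherits the limit of the
    continuous transform.\<close>
  moreover have "\<forall>\<^sub>F p in at (a, b) within {(u, v). u \<noteq> 0 \<and> v \<noteq> 0}.
      (case p of (u, v) \<Rightarrow> cos_transform2 hyp_kernel u v) = (case p of (u, v) \<Rightarrow> hyp_kernel u v)"
    unfolding eventually_at_filter by (rule always_eventually) (auto simp: cos_transform2_hyp_kernel_eq)
  ultimately show "((\<lambda>(u, v). hyp_kernel u v) \<longlongrightarrow> cos_transform2 hyp_kernel a b)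
      (at (a, b) within {(u, v). u \<noteq> 0 \<and> v \<noteq> 0})"
    by (rule Lim_transform_eventually)
qed (use set_integrable_hyp_kernel cos_transform2_hyp_kernel_eq in auto)

end
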